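(* Let $F$ be a one-dimensional tropical fan in $\mathbb{R}^n$ whose rays span $\mathbb{R}^n$. If there exists a non-negative TR function $M$ on $\mathbb{R}^n$ such that $M\cdot F=1$, then $\mathrm{Gly}(F)\neq\emptyset$. Moreover, after a suitable change of coordinates in $\mathrm{GL}_n(\mathbb{Z})$ and a suitable ordering of the rays, the primitive generators $v_1,\dots,v_q$ and weights $\omega_1,\dots,\omega_q$ of $F$ have the following form: - $v_1=(1,0,\dots,0)$ and $\omega_1=1$; - $v_2=(-1,0,\dots,0,m)$ for some integer $m$, and $\omega_2=1$; - $v_i\in(1,0,\dots,0)^\perp$ (i.e. the first coordinate of $v_i$ is $0$) for all $i\ge3$. (For $n=1$ the second item reads $v_2=-1$.)
   Context: A one-dimensional tropical fan $F$ in $\mathbb{R}^n$ consists of finitely many distinct rays $\mathbb{R}_+v_1,\dots,\mathbb{R}_+v_q$ (and the origin), with $v_i\in\mathbb{Z}^n$ primitive, together with positive integer weights $\omega_1,\dots,\omega_q$ satisfying the balancing condition $\sum_i\omega_iv_i=0$. A tropical regular (TR) function on $\mathbb{R}^n$ is $\max(l_1,\dots,l_k)$ with $l_i\in(\mathbb{Z}^n)^\vee$; a non-negative TR function is one of the form $\max(0,l_1,\dots,l_k)$. The intersection number is $M\cdot F=\sum_{i=1}^q\omega_iM(v_i)$. A tropical binomial is a function $L=\max(l,h)$ with $l,h\in(\mathbb{Z}^n)^\vee$. For a tropical binomial $L$ with $L\cdot F=1$, the gallery of $F$ over $L$ is the set of rays $g(F,L)=\{\mathbb{R}_+v_i: L(v_i)+L(-v_i)=1\}$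 (i.e. the rays whose spanned line, with weight $1$, has intersection number $1$ with $L$). $\mathrm{Gly}(F)$ denotes the set of all galleries of $F$. *)

theory Defs
  imports "HOL-Analysis.Analysis"
begin

text \<open>
  \<open>\<real>\<^sup>n\<close> is \<open>real ^ 'n\<close>, \<open>\<int>\<^sup>n\<close> is \<open>int ^ 'n\<close>, and \<open>GL\<^sub>n(\<int>)\<close> consists of the
  integer matrices satisfying \<open>invertible\<close>, whose inverse is required to be integral too.
\<close>

definition of_lattice :: "int ^ 'n \<Rightarrow> real ^ 'n" where
  "of_lattice v = (\<chi> i. of_int (v $ i))"

definition ray :: "int ^ 'n \<Rightarrow> (real ^ 'n) set" where
  "ray v = {c *\<^sub>R of_lattice v | c. c \<ge> 0}"

definition primitive_vec :: "int ^ 'n \<Rightarrow> bool" where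
  "primitive_vec v \<longleftrightarrow> Gcd (range (\<lambda>i. v $ i)) = 1"

text \<open>
  The data of a fan are the number \<open>q\<close> of rays, their generators and their weights; only
  the values of \<open>gen\<close> and \<open>wt\<close> at the indices \<open>1, \<dots>, q\<close> are meaningful.
\<close>

record ('n::finite) fan =
  nrays :: nat
  gen :: "nat \<Rightarrow> int ^ 'n"
  wt :: "nat \<Rightarrow> int"

definition tropical_fan :: "('n::finite) fan \<Rightarrow> bool" where
  "tropical_fan F \<longleftrightarrow>
     inj_on (\<lambda>i. ray (gen F i)) {1..nrays F} \<and>
     (\<forall>i\<in>{1..nrays F}. primitive_vec (gen F i) \<and> wt F i > 0) \<and>
     (\<Sum>i=1..nrays F. wt F i *s gen F i) = 0"

text \<open>
  The dual lattice of \<open>\<int>\<^sup>n\<close>, each form being extended linearly to \<open>\<real>\<^sup>n\<close>.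
\<close>

definition dual_lattice :: "(real ^ 'n \<Rightarrow> real) set" where
  "dual_lattice = {l. linear l \<and> (\<forall>v. l (of_lattice v) \<in> \<int>)}"

definition trop_max :: "(real ^ 'n \<Rightarrow> real) set \<Rightarrow> real ^ 'n \<Rightarrow> real" where
  "trop_max S x = (MAX l\<in>S. l x)"

definition TR :: "(real ^ 'n \<Rightarrow> real) set" where
  "TR = {trop_max S | S. finite S \<and> S \<noteq> {} \<and> S \<subseteq> dual_lattice}"

definition nonneg_TR :: "(real ^ 'n \<Rightarrow> real) set" where
  "nonneg_TR = {M \<in> TR. \<exists>S. finite S \<and> S \<subseteq> dual_lattice \<and> M = trop_max (insert (\<lambda>x. 0) S)}"

definition trop_binomial :: "(real ^ 'n \<Rightarrow> real) set" where
  "trop_binomial = {trop_max {l, h} | l h. l \<in> dual_lattice \<and> h \<in> dual_lattice}"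

definition intersection_number :: "(real ^ 'n \<Rightarrow> real) \<Rightarrow> ('n::finite) fan \<Rightarrow> real" where
  "intersection_number M F = (\<Sum>i=1..nrays F. of_int (wt F i) * M (of_lattice (gen F i)))"

definition gallery :: "('n::finite) fan \<Rightarrow> (real ^ 'n \<Rightarrow> real) \<Rightarrow> (real ^ 'n) set set" where
  "gallery F L = {ray (gen F i) | i. i \<in> {1..nrays F} \<and>
     L (of_lattice (gen F i)) + L (- of_lattice (gen F i)) = 1}"

definition Gly :: "('n::finite) fan \<Rightarrow> (real ^ 'n) set set set" where
  "Gly F = {gallery F L | L. L \<in> trop_binomial \<and> intersection_number L F = 1}"

text \<open>
  The order on the index type fixes which coordinate is the first and which the last; they
  coincide exactly when \<open>n = 1\<close>.
\<close>

definition first_ix :: "'n::{finite,linorder}" where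
  "first_ix = Min UNIV"

definition last_ix :: "'n::{finite,linorder}" where
  "last_ix = Max UNIV"

end

theory Submission
  imports Defs
begin

text \<open>
  Since \<open>M\<close> is non-negative and integral on the lattice, \<open>M \<cdot> F = 1\<close> forces \<open>M\<close> to vanish on all
  generators but one, \<open>v\<^sub>1\<close>, where \<open>\<omega>\<^sub>1 = M v\<^sub>1 = 1\<close>. A form \<open>l\<close> of \<open>M\<close> with \<open>l v\<^sub>1 = 1\<close> is then
  \<open>\<le> 0\<close> on the other generators, and pairing the balancing condition with \<open>l\<close> shows
  that \<open>l\<close> vanishes on all of these but one, \<open>v\<^sub>2\<close>, where \<open>\<omega>\<^sub>2 = 1\<close> and \<open>l v\<^sub>2 = -1\<close>. Hence
  \<open>max(0, l)\<close> has a gallery. Finally \<open>\<int>\<^sup>n = \<int>v\<^sub>1 \<oplus> ker l\<close>, and a basis of \<open>ker l\<close> may be chosen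
  in which \<open>v\<^sub>1 + v\<^sub>2 \<in> ker l\<close> is a multiple of the last vector.
\<close>

section \<open>Unimodular integer matrices\<close>

text \<open>Multiplying by it adds the linear form with coefficients \<open>c\<close> to coordinate
  \<open>f\<close>; for \<open>c $ f = 0\<close> it is a product of elementary matrices.\<close>

definition row_shear :: "'n \<Rightarrow> int ^ 'n \<Rightarrow> int ^ 'n ^ 'n" where
  "row_shear f c = (\<chi> a b. (if a = b then 1 else 0) + (if a = f then c $ b else 0))"

lemma row_shear_mult:
  "(row_shear f c *v x) $ a = x $ a + (if a = f then \<Sum>b\<in>UNIV. c $ b * x $ b else 0)"
  by (simp add: row_shear_def matrix_vector_mult_def distrib_right sum.distrib
      if_distrib[of "\<lambda>z. z * y" for y] cong: if_cong)

text \<open>Since \<open>c\<close> ignores coordinate \<open>f\<close>, its value is the same before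
  and after the inner shear, so the two corrections cancel.\<close>

lemma row_shear_mult_inverse:
  assumes "c $ f = 0"
  shows "row_shear f c ** row_shear f (- c) = mat 1"
proof -
  have "row_shear f c *v (row_shear f (- c) *v x) = x" for x
  proof -
    have "c $ b * (row_shear f (- c) *v x) $ b = c $ b * x $ b" for b
      using assms by (simp add: row_shear_mult)
    then have "(\<Sum>b\<in>UNIV. c $ b * (row_shear f (- c) *v x) $ b) = (\<Sum>b\<in>UNIV. c $ b * x $ b)"
      by (intro sum.cong) auto
    then show ?thesis
      unfolding vec_eq_iff row_shear_mult[of f c] by (simp add: row_shear_mult sum_negf)
  qed
  then show ?thesis
    by (simp add: matrix_eq matrix_vector_mul_assoc)
qed

lemma invertible_row_shear:
  assumes "c $ f = 0"
  shows "invertible (row_shear f c)"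
  using row_shear_mult_inverse[of c f] row_shear_mult_inverse[of "- c" f] assms
  unfolding invertible_def by auto

definition swap_matrix :: "'n \<Rightarrow> 'n \<Rightarrow> int ^ 'n ^ 'n" where
  "swap_matrix j k = (\<chi> a b. if Transposition.transpose j k a = b then 1 else 0)"

lemma swap_matrix_mult: "(swap_matrix j k *v x) $ a = x $ Transposition.transpose j k a"
  by (simp add: swap_matrix_def matrix_vector_mult_def if_distrib[of "\<lambda>z. z * y" for y] cong: if_cong)

lemma invertible_swap_matrix: "invertible (swap_matrix j k)"
proof -
  have "swap_matrix j k ** swap_matrix j k = mat 1"
    by (simp add: matrix_eq matrix_vector_mul_assoc[symmetric] vec_eq_iff swap_matrix_mult)
  then show ?thesis
    unfolding invertible_def by blast
qed

text \<open>Equivalently, the rows and columns of \<open>V\<close> outside \<open>S\<close> are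
  those of the identity. The clause on entries protects those already cleared; the clause on vectors
  keeps a chosen basis vector fixed.\<close>

definition acts_on :: "int ^ 'n ^ 'n \<Rightarrow> 'n set \<Rightarrow> bool" where
  "acts_on V S \<longleftrightarrow> (\<forall>x. (\<forall>a. a \<notin> S \<longrightarrow> (V *v x) $ a = x $ a) \<and>
     ((\<forall>a\<in>S. x $ a = 0) \<longrightarrow> V *v x = x))"

lemma acts_on_mult:
  assumes "acts_on V S" "acts_on W S"
  shows "acts_on (V ** W) S"
  using assms unfolding acts_on_def matrix_vector_mul_assoc[symmetric] by metis

lemma acts_on_mono: "acts_on V S \<Longrightarrow> S \<subseteq> T \<Longrightarrow> acts_on V T"
  unfolding acts_on_def by blast

lemma acts_on_mat_1: "acts_on (mat 1) S"
  unfolding acts_on_def by simp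

lemma acts_on_swap_matrix: "acts_on (swap_matrix j k) {j, k}"
  unfolding acts_on_def
  by (auto simp: swap_matrix_mult vec_eq_iff Transposition.transpose_def)

lemma acts_on_row_shear_axis: "acts_on (row_shear k (axis j c)) {j, k}"
  unfolding acts_on_def
  by (auto simp: row_shear_mult vec_eq_iff axis_def if_distrib[of "\<lambda>z. z * y" for y] cong: if_cong)

text \<open>Euclid's algorithm on the entries at \<open>j\<close> and \<open>k\<close>, by induction
  on the absolute value of the entry at \<open>j\<close>.\<close>

lemma eliminate_entry:
  fixes w :: "int ^ 'n"
  assumes "j \<noteq> k"
  shows "\<exists>V. invertible V \<and> acts_on V {j, k} \<and> (V *v w) $ j = 0"
proof (induction "nat \<bar>w $ j\<bar>" arbitrary: w rule: less_induct)
  case less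
  show ?case
  proof (cases "w $ j = 0")
    case True
    then show ?thesis
      by (intro exI[of _ "mat 1"]) (auto simp: acts_on_mat_1 invertible_def)
  next
    case False
    \<comment> \<open>Subtracting the quotient multiple of entry \<open>j\<close> from entry
      \<open>k\<close> and then swapping puts the remainder \<open>w $ k mod w $ j\<close> at
      \<open>j\<close>.\<close>
    define V where "V = swap_matrix j k ** row_shear k (axis j (- (w $ k div w $ j)))"
    have "invertible V"
      unfolding V_def using assms
      by (intro invertible_mult invertible_swap_matrix invertible_row_shear) (simp add: axis_def)
    moreover have "acts_on V {j, k}"
      unfolding V_def by (intro acts_on_mult acts_on_swap_matrix acts_on_row_shear_axis)
    moreover have "nat \<bar>(V *v w) $ j\<bar> < nat \<bar>w $ j\<bar>"
    proof -
      have "(V *v w) $ j = w $ k - w $ k div w $ j * w $ j"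
        by (simp add: V_def matrix_vector_mul_assoc[symmetric] swap_matrix_mult row_shear_mult
            axis_def if_distrib[of "\<lambda>z. z * y" for y] cong: if_cong)
      then show ?thesis
        using False abs_mod_less[of "w $ j" "w $ k"] by (simp add: minus_div_mult_eq_mod)
    qed
    then obtain W where "invertible W" "acts_on W {j, k}" "(W *v (V *v w)) $ j = 0"
      using less by blast
    ultimately show ?thesis
      by (intro exI[of _ "W ** V"] conjI invertible_mult acts_on_mult)
         (simp_all only: matrix_vector_mul_assoc)
  qed
qed

text \<open>The entries are cleared one by one against the pivot \<open>k\<close>; each step touches
  only \<open>k\<close> and the new index, so earlier zeros survive.\<close>

lemma eliminate_entries:
  fixes w :: "int ^ 'n"
  assumes "finite T" "k \<notin> T"
  shows "\<exists>V. invertible V \<and> acts_on V (insert k T) \<and> (\<forall>a\<in>T. (V *v w) $ a = 0)"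
  using assms
proof (induction T rule: finite_induct)
  case empty
  then show ?case
    by (intro exI[of _ "mat 1"]) (auto simp: acts_on_mat_1 invertible_def)
next
  case (insert j T)
  then obtain V where V: "invertible V" "acts_on V (insert k T)" "\<forall>a\<in>T. (V *v w) $ a = 0"
    by blast
  have "j \<noteq> k"
    using insert.prems by blast
  then obtain W where W: "invertible W" "acts_on W {j, k}" "(W *v (V *v w)) $ j = 0"
    using eliminate_entry by blast
  have "(W *v (V *v w)) $ a = 0" if "a \<in> T" for a
  proof -
    have "a \<notin> {j, k}"
      using that insert.hyps insert.prems by blast
    then show ?thesis
      using W(2) V(3) that unfolding acts_on_def by simp
  qed
  moreover have "acts_on (W ** V) (insert k (insert j T))"
    using V(2) W(2) by (intro acts_on_mult) (auto elim: acts_on_mono)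
  ultimately show ?case
    using V(1) W(1,3)
    by (intro exI[of _ "W ** V"]) (auto simp: invertible_mult matrix_vector_mul_assoc[symmetric])
qed

text \<open>Coordinates for the splitting of the lattice into the multiples of \<open>u\<close> and
  the kernel of \<open>c\<close>. Elimination turns \<open>u\<close> into \<open>d\<close> times a
  basis vector, and the pairing with \<open>c\<close> being 1 forces \<open>d\<close> to be a
  unit.\<close>

lemma unimodular_split:
  fixes c u :: "int ^ 'n" and f :: 'n
  assumes "(\<Sum>b\<in>UNIV. c $ b * u $ b) = 1"
  shows "\<exists>A. invertible A \<and> A *v u = axis f 1 \<and> (\<forall>x. (A *v x) $ f = (\<Sum>b\<in>UNIV. c $ b * x $ b))"
proof -
  obtain U where U: "invertible U" "\<forall>a\<in>- {f}. (U *v u) $ a = 0"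
    using eliminate_entries[of "- {f}" f u] by auto
  then obtain B where B: "B ** U = mat 1"
    unfolding invertible_def by blast
  define d where "d = (U *v u) $ f"
  \<comment> \<open>Read as a one-row matrix, the form is transported by multiplication with
    \<open>B\<close>; \<open>c'\<close> is the form in the coordinates given by
    \<open>U\<close>.\<close>
  define C :: "int ^ 'n ^ 1" where "C = (\<chi> i. c)"
  define c' where "c' = (C ** B) $ 1"
  have c': "(\<Sum>b\<in>UNIV. c' $ b * (U *v x) $ b) = (\<Sum>b\<in>UNIV. c $ b * x $ b)" for x
  proof -
    have "(\<Sum>b\<in>UNIV. c' $ b * (U *v x) $ b) = ((C ** B) *v (U *v x)) $ 1"
      by (simp add: c'_def matrix_vector_mult_def)
    also have "(C ** B) *v (U *v x) = C *v ((B ** U) *v x)"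
      by (simp add: matrix_vector_mul_assoc matrix_mul_assoc)
    finally show ?thesis
      unfolding B matrix_vector_mul_lid by (simp add: C_def matrix_vector_mult_def)
  qed
  have Uu: "U *v u = axis f d"
    using U(2) by (auto simp: vec_eq_iff axis_def d_def)
  have cd: "c' $ f * d = 1"
    using c'[of u] assms by (simp add: Uu axis_def if_distrib[of "\<lambda>z. y * z" for y] cong: if_cong)
  then have dd: "d * d = 1" and c'f: "c' $ f = d"
    by (auto simp: zmult_eq_1_iff)
  \<comment> \<open>The scalar \<open>d = \<plusminus>1\<close> also makes the \<open>f\<close>-entry of the transported form equal to 1,
    so that a shear suffices to turn that form into a coordinate.\<close>
  define A where "A = row_shear f (\<chi> b. if b = f then 0 else d * c' $ b) ** (mat d ** U)"
  have mat_d: "(mat d *v y) $ b = d * y $ b" for y :: "int ^ 'n" and b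
    by (simp add: mat_def matrix_vector_mult_def if_distrib[of "\<lambda>z. z * y" for y] cong: if_cong)
  have "mat d *v (mat d *v y) = y" for y :: "int ^ 'n"
    by (simp add: vec_eq_iff mat_d mult.assoc[symmetric] dd)
  then have "(mat d :: int ^ 'n ^ 'n) ** mat d = mat 1"
    by (simp add: matrix_eq matrix_vector_mul_assoc)
  then have "invertible (mat d :: int ^ 'n ^ 'n)"
    unfolding invertible_def by blast
  then have "invertible A"
    unfolding A_def using U(1) by (intro invertible_mult invertible_row_shear) auto
  moreover have Af: "(A *v x) $ f = (\<Sum>b\<in>UNIV. c $ b * x $ b)" for x
  proof -
    have "(A *v x) $ f = d * (U *v x) $ f +
        (\<Sum>b\<in>UNIV. (if b = f then 0 else d * c' $ b) * (d * (U *v x) $ b))"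
      by (simp add: A_def matrix_vector_mul_assoc[symmetric] row_shear_mult mat_d)
    also have "(\<Sum>b\<in>UNIV. (if b = f then 0 else d * c' $ b) * (d * (U *v x) $ b)) =
        (\<Sum>b\<in>UNIV - {f}. c' $ b * (U *v x) $ b)"
    proof (rule sum.mono_neutral_cong_right)
      show "(if b = f then 0 else d * c' $ b) * (d * (U *v x) $ b) = c' $ b * (U *v x) $ b"
        if "b \<in> UNIV - {f}" for b
        using that dd by (simp add: algebra_simps)
    qed auto
    also have "d * (U *v x) $ f + \<dots> = (\<Sum>b\<in>UNIV. c' $ b * (U *v x) $ b)"
      using sum.remove[of UNIV f "\<lambda>b. c' $ b * (U *v x) $ b"] by (simp add: c'f)
    finally show ?thesis
      by (simp add: c')
  qed
  moreover have "A *v u = axis f 1"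
  proof -
    have "(A *v u) $ a = 0" if "a \<noteq> f" for a
      using that U(2)
      by (simp add: A_def matrix_vector_mul_assoc[symmetric] row_shear_mult mat_d)
    then show ?thesis
      using Af[of u] assms by (auto simp: vec_eq_iff axis_def)
  qed
  ultimately show ?thesis
    by (intro exI[of _ A] conjI allI)
qed

text \<open>After the splitting, \<open>w\<close> has \<open>f\<close>-entry 0, and elimination
  within the other coordinates gathers the rest of it at \<open>k\<close>. That elimination fixes
  \<open>axis f 1\<close> and preserves coordinate \<open>f\<close>.\<close>

lemma unimodular_normal_form:
  fixes c u w :: "int ^ 'n" and f k :: 'n
  assumes u: "(\<Sum>b\<in>UNIV. c $ b * u $ b) = 1" and w: "(\<Sum>b\<in>UNIV. c $ b * w $ b) = 0"
    and "k \<noteq> f"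
  shows "\<exists>A m. invertible A \<and> A *v u = axis f 1 \<and> A *v w = axis k m \<and>
    (\<forall>x. (A *v x) $ f = (\<Sum>b\<in>UNIV. c $ b * x $ b))"
proof -
  obtain A where A: "invertible A" "A *v u = axis f 1"
    "\<And>x. (A *v x) $ f = (\<Sum>b\<in>UNIV. c $ b * x $ b)"
    using unimodular_split[OF u] by blast
  obtain V where V: "invertible V" "acts_on V (insert k (- {f, k}))"
    "\<forall>a\<in>- {f, k}. (V *v (A *v w)) $ a = 0"
    using eliminate_entries[of "- {f, k}" k "A *v w"] by auto
  have "insert k (- {f, k}) = - {f}"
    using \<open>k \<noteq> f\<close> by auto
  with V(2) have Vf: "(V *v x) $ f = x $ f" and Vu: "V *v axis f 1 = axis f 1" for x
    unfolding acts_on_def by (auto simp: axis_def)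
  define m where "m = (V *v (A *v w)) $ k"
  have "V *v (A *v w) = axis k m"
    unfolding m_def using V(3) Vf[of "A *v w"] A(3)[of w] w by (auto simp: vec_eq_iff axis_def)
  then have "(V ** A) *v w = axis k m"
    by (simp only: matrix_vector_mul_assoc)
  moreover have "(V ** A) *v u = axis f 1"
    by (simp only: matrix_vector_mul_assoc[symmetric] A(2) Vu)
  moreover have "((V ** A) *v x) $ f = (\<Sum>b\<in>UNIV. c $ b * x $ b)" for x
    by (simp only: matrix_vector_mul_assoc[symmetric] Vf A(3))
  ultimately show ?thesis
    using invertible_mult[OF V(1) A(1)]
    by (intro exI[of _ "V ** A"] exI[of _ m] conjI allI)
qed

section \<open>Lattice forms and sums equal to one\<close>

text \<open>The coefficients are the values at the standard basis vectors, which are lattice points.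
  This turns real-valued forms into integer pairings.\<close>

lemma dual_lattice_coefficients:
  fixes l :: "real ^ 'n \<Rightarrow> real"
  assumes "l \<in> dual_lattice"
  obtains c :: "int ^ 'n" where "\<And>x. l (of_lattice x) = of_int (\<Sum>b\<in>UNIV. c $ b * x $ b)"
proof -
  have "\<exists>z. l (axis b 1) = of_int z" for b
  proof -
    have "of_lattice (axis b 1) = (axis b 1 :: real ^ 'n)"
      by (simp add: of_lattice_def vec_eq_iff axis_def)
    then have "l (axis b 1) \<in> \<int>"
      using assms unfolding dual_lattice_def by (metis (mono_tags, lifting) mem_Collect_eq)
    then show ?thesis
      by (auto elim: Ints_cases)
  qed
  then obtain c where c: "l (axis b 1) = of_int (c b)" for b
    by metis
  have "linear l"
    using assms by (simp add: dual_lattice_def)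
  have "l (of_lattice x) = of_int (\<Sum>b\<in>UNIV. (vec_lambda c) $ b * x $ b)" for x
  proof -
    have "of_lattice x = (\<Sum>b\<in>UNIV. of_int (x $ b) *\<^sub>R (axis b 1 :: real ^ 'n))"
      by (simp add: of_lattice_def vec_eq_iff axis_def if_distrib[of "\<lambda>z. y * z" for y] cong: if_cong)
    then show ?thesis
      by (simp add: linear_sum[OF \<open>linear l\<close>] linear_scale[OF \<open>linear l\<close>] c mult.commute)
  qed
  then show ?thesis
    using that by blast
qed

text \<open>Non-negative integers adding up to 1 are a single 1 and zeros; a product equal to 1 with
  a positive integer weight has both factors 1.\<close>

lemma weighted_sum_eq_1E:
  fixes \<omega> x :: "'a \<Rightarrow> int"
  assumes "finite I" "\<And>i. i \<in> I \<Longrightarrow> \<omega> i > 0" "\<And>i. i \<in> I \<Longrightarrow> x i \<ge> 0"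
    and "(\<Sum>i\<in>I. \<omega> i * x i) = 1"
  obtains i where "i \<in> I" "\<omega> i = 1" "x i = 1" "\<And>j. j \<in> I \<Longrightarrow> j \<noteq> i \<Longrightarrow> x j = 0"
proof -
  have nn: "\<omega> i * x i \<ge> 0" if "i \<in> I" for i
    using assms(2,3)[OF that] by simp
  have "int (\<Sum>i\<in>I. nat (\<omega> i * x i)) = 1"
    using assms(4) nn by simp
  then have "(\<Sum>i\<in>I. nat (\<omega> i * x i)) = 1"
    by linarith
  then obtain i where i: "i \<in> I" "nat (\<omega> i * x i) = 1"
    "\<And>j. j \<in> I \<Longrightarrow> i \<noteq> j \<Longrightarrow> nat (\<omega> j * x j) = 0"
    using sum_eq_1_iff[OF assms(1)] by auto
  have "\<omega> i * x i = 1"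
    using i(2) by linarith
  then have "\<omega> i = 1" "x i = 1"
    using assms(2)[OF i(1)] by (auto simp: zmult_eq_1_iff)
  moreover have "x j = 0" if "j \<in> I" "j \<noteq> i" for j
    using i(3)[of j] nn[of j] assms(2)[of j] that by auto
  ultimately show ?thesis
    using that i(1) by blast
qed

section \<open>From a non-negative function to two distinguished rays\<close>

lemma zero_in_dual_lattice: "(\<lambda>x. 0) \<in> dual_lattice"
  by (simp add: dual_lattice_def linear_zero)

text \<open>The counting of \<open>weighted_sum_eq_1E\<close> applies twice: to the values of
  \<open>M\<close>, and then, away from \<open>i\<close>, to the negated values of a form attaining
  \<open>M\<close> at \<open>gen F i\<close>.\<close>

lemma nonneg_TR_separates_two_rays:
  fixes F :: "('n::finite) fan"
  assumes F: "tropical_fan F" and M: "M \<in> nonneg_TR" "intersection_number M F = 1"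
  obtains l i j where "l \<in> dual_lattice" "i \<in> {1..nrays F}" "j \<in> {1..nrays F}"
    "l (of_lattice (gen F i)) = 1" "wt F i = 1" "l (of_lattice (gen F j)) = - 1" "wt F j = 1"
    "\<And>k. k \<in> {1..nrays F} \<Longrightarrow> k \<noteq> i \<Longrightarrow> k \<noteq> j \<Longrightarrow> l (of_lattice (gen F k)) = 0"
proof -
  let ?I = "{1..nrays F}"
  have wt: "wt F i > 0" if "i \<in> ?I" for i
    using F that unfolding tropical_fan_def by blast
  obtain S where S: "finite S" "S \<subseteq> dual_lattice" "M = trop_max (insert (\<lambda>x. 0) S)"
    using M(1) unfolding nonneg_TR_def by blast
  have attained: "\<exists>l\<in>insert (\<lambda>x. 0) S. M x = l x" for x
    using Max_in[of "(\<lambda>l. l x) ` insert (\<lambda>x. 0) S"] S(1) unfolding S(3) trop_max_def by auto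
  have le_M: "l x \<le> M x" if "l \<in> insert (\<lambda>x. 0) S" for l x
    using that S(1) unfolding S(3) trop_max_def by (intro Max_ge) auto
  \<comment> \<open>Each value of \<open>M\<close> is a value of one of its forms, hence an integer
    at lattice points.\<close>
  have "\<exists>z. M (of_lattice v) = of_int z" for v
  proof -
    obtain l where "l \<in> insert (\<lambda>x. 0) S" "M (of_lattice v) = l (of_lattice v)"
      using attained by blast
    moreover from this have "l \<in> dual_lattice"
      using S(2) zero_in_dual_lattice by blast
    ultimately show ?thesis
      unfolding dual_lattice_def by (auto elim: Ints_cases)
  qed
  then obtain N where N: "M (of_lattice v) = of_int (N v)" for v
    by metis
  have N_nonneg: "N v \<ge> 0" for v
    using le_M[of "\<lambda>x. 0" "of_lattice v"] by (simp add: N)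
  have N_sum: "(\<Sum>i\<in>?I. wt F i * N (gen F i)) = 1"
  proof -
    have "real_of_int (\<Sum>i\<in>?I. wt F i * N (gen F i)) = 1"
      using M(2) by (simp add: intersection_number_def N)
    then show ?thesis
      by linarith
  qed
  obtain i where i: "i \<in> ?I" "wt F i = 1" "N (gen F i) = 1"
    "\<And>j. j \<in> ?I \<Longrightarrow> j \<noteq> i \<Longrightarrow> N (gen F j) = 0"
    by (rule weighted_sum_eq_1E[OF finite_atLeastAtMost wt N_nonneg N_sum]) blast+
  obtain l where l: "l \<in> insert (\<lambda>x. 0) S" "M (of_lattice (gen F i)) = l (of_lattice (gen F i))"
    using attained by blast
  then have l_dual: "l \<in> dual_lattice"
    using S(2) zero_in_dual_lattice by blast
  obtain c where c: "\<And>x. l (of_lattice x) = of_int (\<Sum>b\<in>UNIV. c $ b * x $ b)"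
    using dual_lattice_coefficients[OF l_dual] by blast
  define h where "h = (\<lambda>x :: int ^ 'n. \<Sum>b\<in>UNIV. c $ b * x $ b)"
  have lh: "l (of_lattice x) = of_int (h x)" for x
    by (simp add: c h_def)
  have hi: "h (gen F i) = 1"
    using l(2) i(3) by (simp add: N lh)
  have h_le: "h (gen F j) \<le> 0" if "j \<in> ?I - {i}" for j
    using le_M[OF l(1), of "of_lattice (gen F j)"] i(4)[of j] that by (simp add: N lh)
  \<comment> \<open>Linearity carries the balancing condition over to the values of
    \<open>h\<close>.\<close>
  have "(\<Sum>k\<in>?I. wt F k * h (gen F k)) = h (\<Sum>k\<in>?I. wt F k *s gen F k)"
    unfolding h_def sum_distrib_left sum_component vector_smult_component
    by (subst sum.swap) (simp add: mult.left_commute)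
  also have "\<dots> = 0"
    using F unfolding tropical_fan_def by (simp add: h_def)
  \<comment> \<open>Ray \<open>i\<close> contributes exactly 1 to a total of 0, so the others
    contribute -1.\<close>
  finally have h_sum: "(\<Sum>k\<in>?I - {i}. wt F k * (- h (gen F k))) = 1"
    using i(1,2) hi sum.remove[of ?I i "\<lambda>k. wt F k * h (gen F k)"] by (simp add: sum_negf)
  obtain j where j: "j \<in> ?I - {i}" "wt F j = 1" "- h (gen F j) = 1"
    "\<And>k. k \<in> ?I - {i} \<Longrightarrow> k \<noteq> j \<Longrightarrow> - h (gen F k) = 0"
    by (rule weighted_sum_eq_1E[OF _ _ _ h_sum]) (use wt h_le in auto)
  show ?thesis
  proof (rule that[OF l_dual i(1) _ _ i(2) _ j(2)])
    show "l (of_lattice (gen F k)) = 0" if "k \<in> ?I" "k \<noteq> i" "k \<noteq> j" for k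
      using j(4)[of k] that by (simp add: lh)
    show "l (of_lattice (gen F j)) = - 1"
      using j(3) by (simp add: lh minus_equation_iff)
  qed (use j(1) hi lh in auto)
qed

text \<open>Two transpositions suffice: \<open>j'\<close> is the preimage of \<open>j\<close> under
  the outer one, and \<open>j' \<noteq> 1\<close> because \<open>i \<noteq> j\<close>, so the inner
  one leaves 1 alone.\<close>

lemma permutes_two_prescribed:
  assumes "i \<in> {1..q}" "j \<in> {1..q}" "i \<noteq> (j::nat)"
  obtains \<sigma> where "\<sigma> permutes {1..q}" "\<sigma> 1 = i" "\<sigma> 2 = j"
proof
  define j' where "j' = Transposition.transpose 1 i j"
  let ?\<sigma> = "Transposition.transpose 1 i \<circ> Transposition.transpose 2 j'"
  have "j' \<in> {1..q}" "j' \<noteq> 1"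
    using assms by (simp_all add: j'_def Transposition.transpose_def)
  moreover have "1 \<in> {1..q}" "2 \<in> {1..q}"
    using assms by auto
  ultimately show "?\<sigma> permutes {1..q}"
    using assms(1) by (simp only: permutes_compose permutes_swap_id)
  show "?\<sigma> 1 = i"
    using \<open>j' \<noteq> 1\<close> by simp
  show "?\<sigma> 2 = j"
    by (simp add: j'_def)
qed

section \<open>The gallery and the adapted coordinates\<close>

theorem theorem3p1:
  fixes F :: "('n::{finite,linorder}) fan"
  assumes "tropical_fan F"
    and "span (\<Union>i\<in>{1..nrays F}. ray (gen F i)) = UNIV"
    and "\<exists>M\<in>nonneg_TR. intersection_number M F = 1"
  shows "Gly F \<noteq> {} \<and>
    (\<exists>(A :: int ^ 'n::{finite,linorder} ^ 'n::{finite,linorder}) \<sigma> m.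
       invertible A \<and> \<sigma> permutes {1..nrays F} \<and> nrays F \<ge> 2 \<and>
       A *v gen F (\<sigma> 1) = (\<chi> j. if j = first_ix then 1 else 0) \<and> wt F (\<sigma> 1) = 1 \<and>
       A *v gen F (\<sigma> 2) = (\<chi> j. if j = first_ix then - 1 else if j = last_ix then m else 0) \<and>
       wt F (\<sigma> 2) = 1 \<and>
       (\<forall>i\<in>{3..nrays F}. (A *v gen F (\<sigma> i)) $ first_ix = 0))"
proof
  let ?I = "{1..nrays F}"
  obtain M where "M \<in> nonneg_TR" "intersection_number M F = 1"
    using assms(3) by blast
  then obtain l i j where l: "l \<in> dual_lattice" and i: "i \<in> ?I" "wt F i = 1"
    and j: "j \<in> ?I" "wt F j = 1" and li: "l (of_lattice (gen F i)) = 1"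
    and lj: "l (of_lattice (gen F j)) = - 1"
    and l0: "\<And>k. k \<in> ?I \<Longrightarrow> k \<noteq> i \<Longrightarrow> k \<noteq> j \<Longrightarrow> l (of_lattice (gen F k)) = 0"
    by (rule nonneg_TR_separates_two_rays[OF assms(1)]) blast
  have "i \<noteq> j"
    using li lj by auto
  show "Gly F \<noteq> {}"
  proof -
    \<comment> \<open>At \<open>gen F j\<close> the form is negative, so the maximum is 0 there and
      only ray \<open>i\<close> contributes.\<close>
    let ?L = "trop_max {l, \<lambda>x. 0}"
    have "?L \<in> trop_binomial"
      unfolding trop_binomial_def using l zero_in_dual_lattice by blast
    moreover have "?L (of_lattice (gen F k)) = (if k = i then 1 else 0)" if "k \<in> ?I" for k
      using l0[OF that] li lj by (cases "k = j") (auto simp: trop_max_def)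
    then have "intersection_number ?L F = (\<Sum>k\<in>?I. if k = i then of_int (wt F k) else 0)"
      unfolding intersection_number_def by (intro sum.cong) auto
    then have "intersection_number ?L F = 1"
      using i by simp
    ultimately show ?thesis
      unfolding Gly_def by blast
  qed
  obtain c where c: "\<And>x. l (of_lattice x) = of_int (\<Sum>b\<in>UNIV. c $ b * x $ b)"
    using dual_lattice_coefficients[OF l] by blast
  have ci: "(\<Sum>b\<in>UNIV. c $ b * gen F i $ b) = 1"
    using li unfolding c by linarith
  have cj: "(\<Sum>b\<in>UNIV. c $ b * gen F j $ b) = - 1"
    using lj unfolding c by linarith
  have ck: "(\<Sum>b\<in>UNIV. c $ b * gen F k $ b) = 0" if "k \<in> ?I" "k \<noteq> i" "k \<noteq> j" for k
    using l0[OF that] unfolding c by linarith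
  have "\<exists>(A :: int ^ 'n::{finite,linorder} ^ 'n::{finite,linorder}) m. invertible A \<and> A *v gen F i = axis first_ix 1 \<and>
      A *v gen F j = (\<chi> b. if b = first_ix then - 1 else if b = last_ix then m else 0) \<and>
      (\<forall>x. (A *v x) $ first_ix = (\<Sum>b\<in>UNIV. c $ b * x $ b))"
  \<comment> \<open>Equal first and last indices mean \<open>n = 1\<close>, where no second
    coordinate can hold \<open>m\<close>.\<close>
  proof (cases "(last_ix :: 'n) = first_ix")
    case True
    have "b = first_ix" for b :: 'n
    proof (rule antisym)
      show "b \<le> first_ix"
        using True Max_ge[of UNIV b] by (simp add: last_ix_def)
      show "first_ix \<le> b"
        by (simp add: first_ix_def)
    qed
    then have eqI: "x = y" if "x $ first_ix = y $ first_ix" for x y :: "int ^ 'n::{finite,linorder}"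
      unfolding vec_eq_iff using that by (metis (full_types))
    obtain A :: "int ^ 'n::{finite,linorder} ^ 'n::{finite,linorder}"
      where A: "invertible A" "A *v gen F i = axis first_ix 1"
      "\<And>x. (A *v x) $ first_ix = (\<Sum>b\<in>UNIV. c $ b * x $ b)"
      using unimodular_split[OF ci] by blast
    \<comment> \<open>The branch for \<open>first_ix\<close> takes precedence, so the witness 0 for
      \<open>m\<close> is an arbitrary choice.\<close>
    have "A *v gen F j = (\<chi> b. if b = first_ix then - 1 else if b = last_ix then 0 else 0)"
      by (rule eqI) (simp add: A(3) cj)
    with A show ?thesis
      by (intro exI[of _ A] exI[of _ 0] conjI allI)
  next
    case False
    \<comment> \<open>The sum of the two generators, unlike \<open>gen F j\<close> itself, lies in
      the kernel of the form, so the normal form applies to it; subtracting the image of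
      \<open>gen F i\<close> recovers that of \<open>gen F j\<close>.\<close>
    have "(\<Sum>b\<in>UNIV. c $ b * (gen F i + gen F j) $ b) = 0"
      using ci cj by (simp add: distrib_left sum.distrib)
    from unimodular_normal_form[OF ci this False] obtain A :: "int ^ 'n::{finite,linorder} ^ 'n::{finite,linorder}" and m
      where A: "invertible A"
      "A *v gen F i = axis first_ix 1" "A *v (gen F i + gen F j) = axis last_ix m"
      "\<And>x. (A *v x) $ first_ix = (\<Sum>b\<in>UNIV. c $ b * x $ b)"
      by blast
    have "A *v gen F j = axis last_ix m - axis first_ix 1"
      using A(2,3) by (simp add: matrix_vector_right_distrib algebra_simps)
    also have "\<dots> = (\<chi> b. if b = first_ix then - 1 else if b = last_ix then m else 0)"
      using False by (auto simp: vec_eq_iff axis_def)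
    finally show ?thesis
      using A(1,2,4) by (intro exI[of _ A] exI[of _ m] conjI allI)
  qed
  then obtain A :: "int ^ 'n::{finite,linorder} ^ 'n::{finite,linorder}" and m
      where A: "invertible A" "A *v gen F i = axis first_ix 1"
    "A *v gen F j = (\<chi> b. if b = first_ix then - 1 else if b = last_ix then m else 0)"
    "\<And>x. (A *v x) $ first_ix = (\<Sum>b\<in>UNIV. c $ b * x $ b)"
    by blast
  obtain \<sigma> where \<sigma>: "\<sigma> permutes ?I" "\<sigma> 1 = i" "\<sigma> 2 = j"
    using permutes_two_prescribed[OF i(1) j(1) \<open>i \<noteq> j\<close>] by blast
  have "(A *v gen F (\<sigma> k)) $ first_ix = 0" if "k \<in> {3..nrays F}" for k
  proof -
    have "\<sigma> k \<noteq> \<sigma> 1" "\<sigma> k \<noteq> \<sigma> 2"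
      using that by (simp_all only: inj_eq[OF permutes_inj[OF \<sigma>(1)]]) auto
    moreover have "\<sigma> k \<in> ?I"
      using permutes_in_image[OF \<sigma>(1), of k] that by simp
    ultimately show ?thesis
      using ck \<sigma>(2,3) by (simp add: A(4))
  qed
  moreover have "nrays F \<ge> 2"
    using i(1) j(1) \<open>i \<noteq> j\<close> by auto
  moreover have "axis first_ix 1 = (\<chi> b :: 'n. if b = first_ix then 1 else (0 :: int))"
    by (auto simp: vec_eq_iff axis_def)
  ultimately show "\<exists>(A :: int ^ 'n::{finite,linorder} ^ 'n::{finite,linorder}) \<sigma> m.
       invertible A \<and> \<sigma> permutes ?I \<and> nrays F \<ge> 2 \<and>
       A *v gen F (\<sigma> 1) = (\<chi> j. if j = first_ix then 1 else 0) \<and> wt F (\<sigma> 1) = 1 \<and>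
       A *v gen F (\<sigma> 2) = (\<chi> j. if j = first_ix then - 1 else if j = last_ix then m else 0) \<and>
       wt F (\<sigma> 2) = 1 \<and> (\<forall>i\<in>{3..nrays F}. (A *v gen F (\<sigma> i)) $ first_ix = 0)"
    using A(1-3) \<sigma> i(2) j(2)
    by (intro exI[of _ A] exI[of _ \<sigma>] exI[of _ m] conjI ballI) simp_all
qed

end
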